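(* Let $k \geq 2$ be an integer. As formal power series, \begin{align*} \mathcal{FO}_k(z, q) := \sum_{j = 0}^\infty \sum_{n = 0}^\infty FO_{j, k}(n) z^j q^n &= \frac{q(1-q)^k + q^{k+1}(1 - 2z) - q^k(1 - z)}{(1 - 2q)\left((1 - q)^k - q^k(1 - q + zq)\right)}\\ &= \frac{q\left((1-q)^{k-1}-q^{k-1}\right)}{(1-2q)\left((1-q)^{k-1}-q^k\right)} \\ &\quad + \sum_{j = 1}^\infty \frac{q^{jk+j-1}\left((1-q)^k-q^k\right)}{(1-2q)(1-q)^{j-1}\left((1-q)^{k-1}-q^k\right)^{j+1}}z^j. \end{align*}
   Context: An integer partition is a weakly decreasing finite sequence $\mu = (\mu_1, \ldots, \mu_m)$ of positive integers (its parts); $\ell(\mu) := m$ is its length. The perimeter of a nonempty partition $\mu$ is $P(\mu) := \mu_1 + \ell(\mu) - 1$. The empty partition is not counted (so there are no partitions of perimeter $0$). $FO_{j,k}(n)$ is the number of partitions with perimeter $n$ having exactly $j$ distinct part sizes that are divisible by $k$. *)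

theory Defs
  imports Complex_Main "HOL-Computational_Algebra.Formal_Power_Series"
begin

unbundle fps_syntax

definition is_partition :: "nat list \<Rightarrow> bool" where
  "is_partition \<mu> \<longleftrightarrow> sorted_wrt (\<ge>) \<mu> \<and> (\<forall>x\<in>set \<mu>. x > 0)"

(* Only meaningful for nonempty \<mu>, since it uses hd. *)
definition perimeter :: "nat list \<Rightarrow> nat" where
  "perimeter \<mu> = hd \<mu> + length \<mu> - 1"

definition FO_partitions :: "nat \<Rightarrow> nat \<Rightarrow> nat \<Rightarrow> nat list set" where
  "FO_partitions j k n =
     {\<mu>. is_partition \<mu> \<and> \<mu> \<noteq> [] \<and> perimeter \<mu> = n \<and> card {d \<in> set \<mu>. k dvd d} = j}"

definition FO :: "nat \<Rightarrow> nat \<Rightarrow> nat \<Rightarrow> nat" where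
  "FO j k n = card (FO_partitions j k n)"

(* FO never takes the junk value card A = 0 of an infinite set A. *)
lemma finite_FO_partitions: "finite (FO_partitions j k n)"
proof (rule finite_subset)
  show "FO_partitions j k n \<subseteq> {xs. set xs \<subseteq> {..n} \<and> length xs \<le> n}"
  proof
    fix \<mu> assume "\<mu> \<in> FO_partitions j k n"
    then show "\<mu> \<in> {xs. set xs \<subseteq> {..n} \<and> length xs \<le> n}"
      by (cases \<mu>) (fastforce simp: FO_partitions_def is_partition_def perimeter_def)+
  qed
  show "finite {xs. set xs \<subseteq> {..n} \<and> length xs \<le> n}"
    by (rule finite_lists_length_le) simp
qed

(* Bivariate series are elements of Q[[q]][[z]]: the outer variable is z, the inner one is q,
   so the coefficient of z^j q^n in F is F $ j $ n. *)
definition FO_gf :: "nat \<Rightarrow> rat fps fps" where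
  "FO_gf k = Abs_fps (\<lambda>j. Abs_fps (\<lambda>n. of_nat (FO j k n)))"

(* Division in Q[[q]][[z]] is the library's division of series.  Its coefficient ring Q[[q]]
   is not a field; the following lemma shows that it is nevertheless the true quotient whenever
   the denominator has constant term (in z and q) different from 0. *)
lemma bivariate_divide_mult:
  fixes f g :: "rat fps fps"
  assumes "g $ 0 $ 0 \<noteq> 0"
  shows "f / g * g = f"
proof -
  have "g $ 0 * inverse (g $ 0) = 1"
    using assms by (rule inverse_mult_eq_1')
  then have "g * inverse g = 1"
    unfolding fps_inverse_def by (rule fps_right_inverse)
  moreover have "g $ 0 \<noteq> 0" using assms by auto
  ultimately show ?thesis
    by (simp add: fps_divide_unit mult.assoc mult.commute[of _ g])
qed

end

theory Submission
  imports Defs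
begin

text \<open>
  A partition with largest part \<open>a\<close> is described by the multiplicities of its parts. With
  \<open>x = q / (1 - q)\<close> and \<open>u = 1 - q + z q\<close>, a part size below \<open>a\<close> contributes \<open>1 / (1 - q)\<close>, or
  \<open>u / (1 - q)\<close> if it is a multiple of \<open>k\<close>, so the partitions with largest part \<open>a + 1\<close>
  contribute \<open>f a = x ^ (a + 1) * u ^ (a div k)\<close> to the series, times \<open>z\<close> if \<open>k\<close> divides \<open>a + 1\<close>.
  Since \<open>f (a + k) = u * x ^ k * f a\<close>, the series \<open>F\<close> satisfies
  \<open>F = x + \<dots> + x ^ (k - 1) + z * x ^ k + u * x ^ k * F\<close>, which is the first formula. Its
  denominator is linear in \<open>z\<close>, and comparing coefficients of \<open>z\<close> gives the second one.
\<close>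

section \<open>Counting partitions by largest part, length and number of multiples of
  \<open>k\<close>\<close>

definition num_multiples :: "nat \<Rightarrow> nat list \<Rightarrow> nat" where
  "num_multiples k \<mu> = card {d \<in> set \<mu>. k dvd d}"

definition head_partitions :: "nat \<Rightarrow> nat \<Rightarrow> nat \<Rightarrow> nat \<Rightarrow> nat list set" where
  "head_partitions k a j m =
     {\<mu>. is_partition \<mu> \<and> \<mu> \<noteq> [] \<and> hd \<mu> = a \<and> length \<mu> = m \<and> num_multiples k \<mu> = j}"

definition bounded_partitions :: "nat \<Rightarrow> nat \<Rightarrow> nat \<Rightarrow> nat \<Rightarrow> nat list set" where
  "bounded_partitions k a j m =
     {\<mu>. is_partition \<mu> \<and> set \<mu> \<subseteq> {..a} \<and> length \<mu> = m \<and> num_multiples k \<mu> = j}"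

lemma is_partition_Cons:
  "is_partition (a # \<mu>) \<longleftrightarrow> a > 0 \<and> set \<mu> \<subseteq> {..a} \<and> is_partition \<mu>"
  by (auto simp: is_partition_def)

text \<open>In a weakly decreasing list the maximal allowed value \<open>Suc a\<close> can only
  occur if it comes first.\<close>

lemma hd_eq_bound_iff:
  assumes "is_partition \<mu>" "set \<mu> \<subseteq> {..Suc a}"
  shows "\<mu> \<noteq> [] \<and> hd \<mu> = Suc a \<longleftrightarrow> \<not> set \<mu> \<subseteq> {..a}"
  using assms by (cases \<mu>) (auto simp: is_partition_Cons le_Suc_eq)

lemma is_partition_set_le_hd:
  "is_partition \<mu> \<Longrightarrow> set \<mu> \<subseteq> {..hd \<mu>}"
  by (cases \<mu>) (auto simp: is_partition_Cons)

lemma finite_bounded_partitions: "finite (bounded_partitions k a j m)"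
  by (rule finite_subset[OF _ finite_lists_length_eq[of "{..a}" m]])
     (auto simp: bounded_partitions_def)

lemma head_partitions_subset: "head_partitions k a j m \<subseteq> bounded_partitions k a j m"
  using is_partition_set_le_hd by (auto simp: head_partitions_def bounded_partitions_def)

lemma finite_head_partitions: "finite (head_partitions k a j m)"
  by (rule finite_subset[OF head_partitions_subset finite_bounded_partitions])

lemma head_partitions_0: "head_partitions k a j 0 = {}"
  by (auto simp: head_partitions_def)

lemma card_bounded_partitions_0:
  "card (bounded_partitions k 0 j m) = (if j = 0 \<and> m = 0 then 1 else 0)"
proof -
  have "\<mu> \<in> bounded_partitions k 0 j m \<longleftrightarrow> \<mu> = [] \<and> j = 0 \<and> m = 0" for \<mu>
    by (cases \<mu>) (auto simp: bounded_partitions_def is_partition_def num_multiples_def)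
  then have "bounded_partitions k 0 j m = (if j = 0 \<and> m = 0 then {[]} else {})"
    by (intro set_eqI) simp
  then show ?thesis by simp
qed

text \<open>A partition with parts at most \<open>Suc a\<close> either avoids \<open>Suc a\<close>
  or begins with it.\<close>

lemma card_bounded_partitions_Suc:
  "card (bounded_partitions k (Suc a) j m) =
     card (bounded_partitions k a j m) + card (head_partitions k (Suc a) j m)"
proof -
  have "bounded_partitions k (Suc a) j m =
      bounded_partitions k a j m \<union> head_partitions k (Suc a) j m"
    using head_partitions_subset[of k "Suc a" j m] hd_eq_bound_iff[of _ a]
    by (fastforce simp: bounded_partitions_def head_partitions_def)
  moreover have "bounded_partitions k a j m \<inter> head_partitions k (Suc a) j m = {}"
    by (auto simp: bounded_partitions_def head_partitions_def dest: hd_in_set)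
  ultimately show ?thesis
    by (simp add: card_Un_disjoint finite_bounded_partitions finite_head_partitions)
qed

lemma num_multiples_Cons:
  "num_multiples k (a # \<mu>) = num_multiples k \<mu> + (if k dvd a \<and> a \<notin> set \<mu> then 1 else 0)"
proof -
  have "{d \<in> set (a # \<mu>). k dvd d} =
      (if k dvd a then insert a {d \<in> set \<mu>. k dvd d} else {d \<in> set \<mu>. k dvd d})"
    by auto
  then show ?thesis by (auto simp: num_multiples_def card_insert_if)
qed

text \<open>Delete the first part \<open>Suc a\<close>. Either the tail begins with
  \<open>Suc a\<close> again and has the same part sizes, or its parts are at most \<open>a\<close>
  and the size \<open>Suc a\<close> is lost, which lowers the count of multiples exactly when
  \<open>k\<close> divides \<open>Suc a\<close>.\<close>

lemma card_head_partitions_Suc: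
  "card (head_partitions k (Suc a) j (Suc m)) = card (head_partitions k (Suc a) j m) +
     (if k dvd Suc a then (if j = 0 then 0 else card (bounded_partitions k a (j - 1) m))
      else card (bounded_partitions k a j m))"
proof -
  \<comment> \<open>\<open>R\<close> holds the tails in which \<open>Suc a\<close> no longer occurs.
    Adding on the side of \<open>num_multiples\<close> keeps truncated subtraction out when
    \<open>j = 0\<close>.\<close>
  define R where "R = {\<mu>. is_partition \<mu> \<and> set \<mu> \<subseteq> {..a} \<and> length \<mu> = m \<and>
     num_multiples k \<mu> + (if k dvd Suc a then 1 else 0) = j}"
  have R: "R = (if k dvd Suc a then (if j = 0 then {} else bounded_partitions k a (j - 1) m)
      else bounded_partitions k a j m)"
    by (auto simp: R_def bounded_partitions_def)
  have "head_partitions k (Suc a) j (Suc m) = (#) (Suc a) ` (head_partitions k (Suc a) j m \<union> R)"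
    (is "?A = ?B")
  proof (intro equalityI subsetI)
    fix \<nu> assume "\<nu> \<in> ?A"
    then obtain \<mu> where \<mu>: "\<nu> = Suc a # \<mu>" "is_partition \<mu>" "set \<mu> \<subseteq> {..Suc a}" "length \<mu> = m"
        "num_multiples k (Suc a # \<mu>) = j"
      by (cases \<nu>) (auto simp: head_partitions_def is_partition_Cons)
    have "\<mu> \<in> head_partitions k (Suc a) j m \<union> R"
    proof (cases "set \<mu> \<subseteq> {..a}")
      case True
      then have "Suc a \<notin> set \<mu>" by auto
      then show ?thesis using True \<mu> by (auto simp: R_def num_multiples_Cons)
    next
      case False
      then have "\<mu> \<noteq> []" "hd \<mu> = Suc a" using hd_eq_bound_iff \<mu> by blast+
      moreover from this have "Suc a \<in> set \<mu>" using hd_in_set by metis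
      ultimately show ?thesis using \<mu> by (auto simp: head_partitions_def num_multiples_Cons)
    qed
    then show "\<nu> \<in> ?B" using \<mu> by simp
  next
    fix \<nu> assume "\<nu> \<in> ?B"
    then obtain \<mu> where \<mu>: "\<nu> = Suc a # \<mu>" "\<mu> \<in> head_partitions k (Suc a) j m \<or> \<mu> \<in> R"
      by auto
    from \<mu>(2) show "\<nu> \<in> ?A"
    proof
      assume *: "\<mu> \<in> head_partitions k (Suc a) j m"
      then have "Suc a \<in> set \<mu>" using hd_in_set by (fastforce simp: head_partitions_def)
      then show ?thesis using * \<mu>(1) is_partition_set_le_hd[of \<mu>]
        by (auto simp: head_partitions_def is_partition_Cons num_multiples_Cons)
    next
      assume *: "\<mu> \<in> R"
      then have "Suc a \<notin> set \<mu>" by (auto simp: R_def)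
      then show ?thesis using * \<mu>(1)
        by (auto simp: R_def head_partitions_def is_partition_Cons num_multiples_Cons
            split: if_splits)
    qed
  qed
  then have "card (head_partitions k (Suc a) j (Suc m)) = card (head_partitions k (Suc a) j m \<union> R)"
    by (simp add: card_image)
  also have "\<dots> = card (head_partitions k (Suc a) j m) + card R"
  proof (rule card_Un_disjoint)
    show "finite R" by (simp add: R finite_bounded_partitions)
    show "head_partitions k (Suc a) j m \<inter> R = {}"
      by (auto simp: R_def head_partitions_def dest: hd_in_set)
  qed (rule finite_head_partitions)
  finally show ?thesis by (simp add: R)
qed

text \<open>Largest part \<open>Suc a\<close> and perimeter \<open>n\<close> force the length to be
  \<open>n - a\<close>.\<close>

lemma FO_eq_sum: "FO j k n = (\<Sum>a<n. card (head_partitions k (Suc a) j (n - a)))"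
proof -
  have "FO_partitions j k n = (\<Union>a<n. head_partitions k (Suc a) j (n - a))"
  proof (intro equalityI subsetI)
    fix \<mu> assume \<mu>: "\<mu> \<in> FO_partitions j k n"
    then have pos: "hd \<mu> > 0" "length \<mu> > 0" and n: "n = hd \<mu> + length \<mu> - 1"
      by (auto simp: FO_partitions_def is_partition_def perimeter_def)
    have "\<mu> \<in> head_partitions k (Suc (hd \<mu> - 1)) j (n - (hd \<mu> - 1))"
      using \<mu> pos n by (auto simp: FO_partitions_def head_partitions_def num_multiples_def)
    moreover have "hd \<mu> - 1 < n" using pos n by linarith
    ultimately show "\<mu> \<in> (\<Union>a<n. head_partitions k (Suc a) j (n - a))" by blast
  qed (auto simp: FO_partitions_def head_partitions_def num_multiples_def perimeter_def)
  moreover have "card (\<Union>a<n. head_partitions k (Suc a) j (n - a)) =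
      (\<Sum>a<n. card (head_partitions k (Suc a) j (n - a)))"
    by (rule card_UN_disjoint) (use finite_head_partitions in \<open>auto simp: head_partitions_def\<close>)
  ultimately show ?thesis by (simp add: FO_def)
qed

section \<open>Generating functions for a fixed largest part\<close>

abbreviation (input) Z :: "rat fps fps" where "Z \<equiv> fps_X"

abbreviation (input) Q :: "rat fps fps" where "Q \<equiv> fps_const fps_X"

text \<open>Here \<open>q\<close> marks the length only; the factor \<open>Q ^ a\<close> that turns
  length into perimeter is supplied in \<open>FO_gf_approx\<close>.\<close>

definition head_gf :: "nat \<Rightarrow> nat \<Rightarrow> rat fps fps" where
  "head_gf k a = Abs_fps (\<lambda>j. Abs_fps (\<lambda>m. of_nat (card (head_partitions k a j m))))"

definition bounded_gf :: "nat \<Rightarrow> nat \<Rightarrow> rat fps fps" where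
  "bounded_gf k a = Abs_fps (\<lambda>j. Abs_fps (\<lambda>m. of_nat (card (bounded_partitions k a j m))))"

lemma nth_Q_power_mult: "(Q ^ N * f) $ j $ n = (if n < N then 0 else f $ j $ (n - N))"
  by (simp add: fps_X_power_mult_nth)

text \<open>Divisibility by \<open>Q ^ N\<close> serves as congruence modulo \<open>q ^ N\<close>
  and replaces convergence in \<open>q\<close>, which is the inner variable.\<close>

lemma Q_power_dvd_iff: "Q ^ N dvd f \<longleftrightarrow> (\<forall>j. \<forall>n<N. f $ j $ n = 0)"
proof
  assume "\<forall>j. \<forall>n<N. f $ j $ n = 0"
  then have "f = Q ^ N * Abs_fps (\<lambda>j. fps_shift N (f $ j))"
    by (auto simp: fps_eq_iff nth_Q_power_mult simp del: fps_const_power)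
  then show "Q ^ N dvd f" by (rule dvdI)
qed (auto simp: nth_Q_power_mult simp del: fps_const_power elim!: dvdE)

lemma bounded_gf_0: "bounded_gf k 0 = 1"
  by (auto simp: fps_eq_iff bounded_gf_def card_bounded_partitions_0)

lemma bounded_gf_Suc: "bounded_gf k (Suc a) = bounded_gf k a + head_gf k (Suc a)"
  by (simp add: fps_eq_iff bounded_gf_def head_gf_def card_bounded_partitions_Suc)

lemma head_gf_Suc:
  "(1 - Q) * head_gf k (Suc a) = Q * (if k dvd Suc a then Z else 1) * bounded_gf k a"
proof -
  have "head_gf k (Suc a) $ j $ m =
      (Q * (head_gf k (Suc a) + (if k dvd Suc a then Z else 1) * bounded_gf k a)) $ j $ m" for j m
    by (cases m) (auto simp: head_gf_def bounded_gf_def head_partitions_0 card_head_partitions_Suc)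
  then have "head_gf k (Suc a) =
      Q * (head_gf k (Suc a) + (if k dvd Suc a then Z else 1) * bounded_gf k a)"
    by (simp add: fps_eq_iff)
  then show ?thesis by (simp add: algebra_simps)
qed

text \<open>Admitting the part size \<open>Suc a\<close> multiplies the series by
  \<open>1 / (1 - q)\<close>, or by \<open>(1 - q + z * q) / (1 - q)\<close> if \<open>k\<close>
  divides \<open>Suc a\<close>; the latter happens \<open>a div k\<close> times among the sizes up
  to \<open>a\<close>.\<close>

lemma bounded_gf_closed:
  assumes "k > 0"
  shows "(1 - Q) ^ a * bounded_gf k a = (1 - Q + Z * Q) ^ (a div k)"
proof (induction a)
  case (Suc a)
  have "(1 - Q) * bounded_gf k (Suc a) =
      (1 - Q + Q * (if k dvd Suc a then Z else 1)) * bounded_gf k a"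
    by (simp only: bounded_gf_Suc distrib_left distrib_right head_gf_Suc)
  then have "(1 - Q) ^ Suc a * bounded_gf k (Suc a) =
      (1 - Q + Q * (if k dvd Suc a then Z else 1)) * (1 - Q + Z * Q) ^ (a div k)"
    by (simp only: power_Suc2 mult.assoc mult.left_commute[of "(1 - Q) ^ a"] Suc.IH)
  moreover have "Suc a div k = (if k dvd Suc a then Suc (a div k) else a div k)"
    by (simp add: div_Suc dvd_eq_mod_eq_0)
  ultimately show ?case by (auto simp: mult.commute)
qed (simp add: bounded_gf_0)

lemma head_gf_closed:
  assumes "k > 0"
  shows "(1 - Q) ^ Suc a * head_gf k (Suc a) =
    Q * (if k dvd Suc a then Z else 1) * (1 - Q + Z * Q) ^ (a div k)"
  by (simp only: power_Suc2 mult.assoc head_gf_Suc mult.left_commute[of "(1 - Q) ^ a"]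
      bounded_gf_closed[OF assms])

text \<open>Modulo \<open>q ^ N\<close> only largest parts up to \<open>N\<close> matter, because
  the perimeter is at least the largest part.\<close>

lemma FO_gf_approx: "Q ^ N dvd FO_gf k - (\<Sum>a<N. Q ^ a * head_gf k (Suc a))"
proof -
  have "(\<Sum>a<N. Q ^ a * head_gf k (Suc a)) $ j $ n = FO_gf k $ j $ n" if "n < N" for j n
  proof -
    have "(\<Sum>a<N. Q ^ a * head_gf k (Suc a)) $ j $ n =
        (\<Sum>a<N. if n < a then 0 else head_gf k (Suc a) $ j $ (n - a))"
      by (simp add: fps_sum_nth nth_Q_power_mult del: fps_const_power)
    \<comment> \<open>The term \<open>a = n\<close> vanishes too: it would count nonempty partitions
      of length 0.\<close>
    also have "\<dots> = (\<Sum>a<n. head_gf k (Suc a) $ j $ (n - a))"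
      using that by (intro sum.mono_neutral_cong_right)
        (auto simp: head_gf_def head_partitions_0 not_less)
    finally show ?thesis by (simp add: FO_gf_def FO_eq_sum head_gf_def)
  qed
  then show ?thesis by (simp add: Q_power_dvd_iff del: fps_const_power)
qed

section \<open>The functional equation and the first formula\<close>

lemma FO_gf_functional_equation:
  fixes x :: "rat fps fps"
  assumes k: "k > 0" and x: "(1 - Q) * x = Q"
  shows "FO_gf k = (\<Sum>a<k - 1. x ^ Suc a) + Z * x ^ k + (1 - Q + Z * Q) * x ^ k * FO_gf k"
proof -
  define y where "y = (1 - Q + Z * Q) * x ^ k"
  define f where "f a = Q ^ a * head_gf k (Suc a)" for a
  have nz: "1 - Q \<noteq> 0"
  proof
    assume "1 - Q = 0"
    then have "(1 - Q) $ 0 $ 0 = 0" by (simp only: fps_zero_nth)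
    then show False by simp
  qed
  have f: "f a = x ^ Suc a * (if k dvd Suc a then Z else 1) * (1 - Q + Z * Q) ^ (a div k)" for a
  proof -
    have "(1 - Q) ^ Suc a * f a =
        Q ^ Suc a * (if k dvd Suc a then Z else 1) * (1 - Q + Z * Q) ^ (a div k)"
      unfolding f_def mult.left_commute[of _ "Q ^ a"] head_gf_closed[OF k]
      by (simp only: power_Suc2 mult.assoc)
    also have "Q ^ Suc a = (1 - Q) ^ Suc a * x ^ Suc a"
      by (simp only: x power_mult_distrib[symmetric])
    finally show ?thesis using nz by (simp only: mult.assoc mult_left_cancel power_not_zero simp_thms)
  qed
  have f_add: "f (a + k) = y * f a" for a
  proof -
    have "k dvd Suc (a + k) \<longleftrightarrow> k dvd Suc a"
      using dvd_add_left_iff[of k k "Suc a"] by simp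
    then show ?thesis using k by (simp add: f y_def power_add mult_ac)
  qed
  have "(\<Sum>a<k. f a) = (\<Sum>a<k - 1. f a) + f (k - 1)"
    using k by (cases k) auto
  moreover have "(\<Sum>a<k - 1. f a) = (\<Sum>a<k - 1. x ^ Suc a)"
    by (intro sum.cong) (auto simp: f dest!: dvd_imp_le)
  moreover have "f (k - 1) = Z * x ^ k"
    using k by (simp add: f)
  ultimately have base: "(\<Sum>a<k. f a) = (\<Sum>a<k - 1. x ^ Suc a) + Z * x ^ k"
    by simp
  \<comment> \<open>This is the functional equation for partial sums: the first \<open>k\<close>
    terms stay, and the remaining ones are \<open>y\<close> times a shorter partial sum.\<close>
  have shift: "(\<Sum>a<N + k. f a) = (\<Sum>a<k. f a) + y * (\<Sum>a<N. f a)" for N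
    by (induction N) (simp_all add: f_add algebra_simps)
  \<comment> \<open>The defect of the functional equation is divisible by every power of
    \<open>Q\<close>, hence zero.\<close>
  define D where "D = FO_gf k - ((\<Sum>a<k. f a) + y * FO_gf k)"
  have "Q ^ N dvd D" for N
  proof -
    have "Q ^ N dvd FO_gf k - (\<Sum>a<N + k. f a)"
      using FO_gf_approx[of "N + k" k] power_le_dvd[of Q "N + k" _ N] by (simp add: f_def)
    moreover have "Q ^ N dvd y * (FO_gf k - (\<Sum>a<N. f a))"
      using FO_gf_approx[of N k] by (simp add: f_def)
    ultimately have "Q ^ N dvd (FO_gf k - (\<Sum>a<N + k. f a)) - y * (FO_gf k - (\<Sum>a<N. f a))"
      by (rule dvd_diff)
    also have "\<dots> = D" by (simp add: D_def shift algebra_simps)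
    finally show ?thesis .
  qed
  then have "D $ j $ n = 0" for j n
    using Q_power_dvd_iff[of "Suc n" D] by blast
  then have "D = 0" by (simp add: fps_eq_iff)
  then show ?thesis by (simp add: D_def base y_def)
qed

text \<open>To be read with \<open>w = x ^ k\<close>, \<open>P = (1 - q) ^ k\<close>,
  \<open>T = q ^ k\<close> and \<open>S\<close> the geometric sum. Treating these as opaque ring
  elements leaves only polynomial algebra, with \<open>(1 - q) * (1 - x) = 1 - 2 * q\<close> at its
  core.\<close>

lemma clear_denominators:
  fixes F q x z S P w T :: "'a :: comm_ring_1"
  assumes x: "(1 - q) * x = q" and w: "P * w = T" and S: "(1 - x) * S = x - w"
    and F: "F = S + z * w + (1 - q + z * q) * w * F"
  shows "F * ((1 - 2 * q) * (P - T * (1 - q + z * q))) = q * P + q * T * (1 - 2 * z) - T * (1 - z)"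
proof -
  have F': "F * (1 - (1 - q + z * q) * w) = S + z * w"
    using F by (simp add: algebra_simps)
  have p: "(1 - q) * (1 - x) = 1 - 2 * q"
    using x by (simp add: algebra_simps)
  have "F * ((1 - 2 * q) * (P - T * (1 - q + z * q))) =
      P * (1 - 2 * q) * (F * (1 - (1 - q + z * q) * w))"
    unfolding w[symmetric] by (simp add: algebra_simps)
  also have "\<dots> = P * (1 - 2 * q) * S + (1 - 2 * q) * z * (P * w)"
    unfolding F' by (simp add: algebra_simps)
  also have "P * (1 - 2 * q) * S = P * (1 - q) * ((1 - x) * S)"
    unfolding p[symmetric] by (simp add: mult_ac)
  also have "\<dots> = P * ((1 - q) * x) - (1 - q) * (P * w)"
    unfolding S by (simp add: algebra_simps)
  finally show ?thesis unfolding x w by (simp add: algebra_simps)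
qed

lemma FO_gf_cross_multiplied:
  assumes k: "k > 0"
  shows "FO_gf k * ((1 - 2 * Q) * ((1 - Q) ^ k - Q ^ k * (1 - Q + Z * Q))) =
    Q * (1 - Q) ^ k + Q ^ (k + 1) * (1 - 2 * Z) - Q ^ k * (1 - Z)"
proof -
  define x :: "rat fps fps" where "x = fps_const (fps_X * inverse (1 - fps_X))"
  have "(1 - Q) * x = fps_const ((1 - fps_X) * (fps_X * inverse (1 - fps_X)))"
    by (simp only: x_def fps_const_mult[symmetric] fps_const_sub[symmetric] fps_const_1_eq_1)
  also have "(1 - fps_X) * (fps_X * inverse (1 - fps_X)) = (fps_X :: rat fps)"
    by (simp add: inverse_mult_eq_1' mult.left_commute)
  finally have x: "(1 - Q) * x = Q" .
  have xk: "(1 - Q) ^ k * x ^ k = Q ^ k"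
    by (simp only: x power_mult_distrib[symmetric])
  have "(1 - x) * (\<Sum>a<n. x ^ Suc a) = x - x ^ Suc n" for n
  proof (induction n)
    case (Suc n)
    then show ?case unfolding sum.lessThan_Suc distrib_left by (simp add: left_diff_distrib)
  qed simp
  from this[of "k - 1"] have geom: "(1 - x) * (\<Sum>a<k - 1. x ^ Suc a) = x - x ^ k"
    using k by simp
  show ?thesis
    using clear_denominators[OF x xk geom FO_gf_functional_equation[OF k x]]
    by (simp only: Suc_eq_plus1[symmetric] power_Suc)
qed

section \<open>Coefficients of \<open>z\<close> and the second formula\<close>

text \<open>The denominator is \<open>s * (p * E) - s * q ^ (k + 1) * z\<close>, so comparing
  coefficients of \<open>z\<close> amounts to a first-order recurrence for \<open>R\<close>. Its
  instances at 0, at 1 and from 2 on are \<open>c0\<close>, \<open>c1\<close> and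
  \<open>c2\<close>.\<close>

lemma second_form_cross_multiplied:
  fixes q :: "rat fps" and k :: nat and R :: "nat \<Rightarrow> rat fps"
  defines "q \<equiv> fps_X"
  assumes k: "k \<ge> 2"
    and R0: "R 0 = q * ((1 - q) ^ (k - 1) - q ^ (k - 1)) / ((1 - 2 * q) * ((1 - q) ^ (k - 1) - q ^ k))"
    and R: "\<And>j. R (Suc j) = q ^ (Suc j * k + Suc j - 1) * ((1 - q) ^ k - q ^ k)
              / ((1 - 2 * q) * (1 - q) ^ (Suc j - 1) * ((1 - q) ^ (k - 1) - q ^ k) ^ (Suc j + 1))"
  shows "Abs_fps R * ((1 - 2 * Q) * ((1 - Q) ^ k - Q ^ k * (1 - Q + Z * Q))) =
    Q * (1 - Q) ^ k + Q ^ (k + 1) * (1 - 2 * Z) - Q ^ k * (1 - Z)"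
proof -
  obtain l where l: "k = Suc (Suc l)" using k by (metis Suc_le_D numeral_2_eq_2 Suc_le_mono)
  define s where "s = 1 - 2 * q"
  define p where "p = 1 - q"
  define E where "E = p ^ (k - 1) - q ^ k"
  \<comment> \<open>Constant term 1 makes \<open>s\<close>, \<open>p\<close> and \<open>E\<close>
    units, so all divisions by their products are exact.\<close>
  have s0: "s $ 0 = 1" and p0: "p $ 0 = 1" and E0: "E $ 0 = 1"
    by (simp_all add: s_def p_def E_def q_def l fps_nth_power_0)
  have nz: "s \<noteq> 0" "p \<noteq> 0" "E \<noteq> 0"
    using s0 p0 E0 by auto
  have div: "f / g * g = f" if "g $ 0 = 1" for f g :: "rat fps"
    by (rule dvd_div_mult_self, rule unit_imp_dvd) (simp add: that)
  have r0: "R 0 * (s * E) = q * (p ^ (k - 1) - q ^ (k - 1))"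
    unfolding R0 p_def[symmetric] s_def[symmetric] E_def[symmetric]
    by (rule div) (simp add: s0 E0)
  have rS: "R (Suc j) * (s * p ^ j * E ^ (j + 2)) = q ^ (Suc j * k + j) * (p ^ k - q ^ k)" for j
    using div[of "s * p ^ j * E ^ (j + 2)" "q ^ (Suc j * k + j) * (p ^ k - q ^ k)"]
    unfolding R p_def[symmetric] s_def[symmetric] E_def[symmetric]
    by (simp add: s0 E0 p0 fps_nth_power_0)
  have c0: "s * (p * E) * R 0 = q * p ^ k - q ^ k * p"
    using arg_cong[OF r0, of "(*) p"] by (simp add: l algebra_simps)
  have c1: "s * (p * E) * R 1 = s * q ^ (k + 1) * R 0 + s * q ^ k"
  proof -
    have "E * (s * (p * E) * R 1) = p * (R (Suc 0) * (s * p ^ 0 * E ^ (0 + 2)))"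
      by (simp add: power2_eq_square mult_ac)
    also have "\<dots> = p * (q ^ k * (p ^ k - q ^ k))"
      unfolding rS by simp
    \<comment> \<open>The identity rests on \<open>p ^ 2 = q ^ 2 + s\<close>.\<close>
    also have "\<dots> = q ^ (k + 1) * (q * (p ^ (k - 1) - q ^ (k - 1))) + s * q ^ k * E"
      by (simp add: E_def l s_def p_def) (simp add: algebra_simps power2_eq_square)
    also have "\<dots> = E * (s * q ^ (k + 1) * R 0 + s * q ^ k)"
      unfolding r0[symmetric] by (simp add: algebra_simps)
    finally show ?thesis using nz by simp
  qed
  have c2: "s * (p * E) * R (Suc (Suc j)) = s * q ^ (k + 1) * R (Suc j)" for j
  proof -
    have "(p ^ j * E ^ (j + 2)) * (s * (p * E) * R (Suc (Suc j))) =
        R (Suc (Suc j)) * (s * p ^ Suc j * E ^ (Suc j + 2))"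
      by (simp add: mult_ac)
    also have "\<dots> = q ^ (k + 1) * (q ^ (Suc j * k + j) * (p ^ k - q ^ k))"
      unfolding rS by (simp add: power_add mult_ac)
    also have "\<dots> = (p ^ j * E ^ (j + 2)) * (s * q ^ (k + 1) * R (Suc j))"
      unfolding rS[symmetric] by (simp add: mult_ac)
    finally show ?thesis using nz by simp
  qed
  have pE: "p * E = p ^ k - q ^ k * p"
    by (simp add: E_def l algebra_simps)
  have const_eqs: "fps_const s = 1 - 2 * Q" "fps_const p = 1 - Q" "fps_const q = Q"
    by (simp_all only: s_def p_def q_def fps_const_mult[symmetric] fps_const_sub[symmetric]
        fps_const_1_eq_1 fps_numeral_fps_const)
  note push = fps_const_mult[symmetric] fps_const_sub[symmetric] fps_const_power[symmetric]
  have den: "(1 - 2 * Q) * ((1 - Q) ^ k - Q ^ k * (1 - Q + Z * Q)) =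
      fps_const (s * (p * E)) - fps_const (s * q ^ (k + 1)) * Z"
    unfolding pE push const_eqs
    by (simp add: algebra_simps del: fps_const_mult fps_const_power)
  have num: "Q * (1 - Q) ^ k + Q ^ (k + 1) * (1 - 2 * Z) - Q ^ k * (1 - Z) =
      fps_const (q * p ^ k - q ^ k * p) + fps_const (s * q ^ k) * Z"
    unfolding push const_eqs
    by (simp add: algebra_simps del: fps_const_mult fps_const_power)
  have "(Abs_fps R * (fps_const (s * (p * E)) - fps_const (s * q ^ (k + 1)) * Z)) $ j =
      (fps_const (q * p ^ k - q ^ k * p) + fps_const (s * q ^ k) * Z) $ j" for j
  proof -
    have "(Abs_fps R * (fps_const (s * (p * E)) - fps_const (s * q ^ (k + 1)) * Z)) $ j =
        s * (p * E) * R j - s * q ^ (k + 1) * (if j = 0 then 0 else R (j - 1))"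
      by (simp add: right_diff_distrib mult.commute[of "Abs_fps R"] mult.assoc
          fps_mult_left_const_nth)
    also have "\<dots> = (fps_const (q * p ^ k - q ^ k * p) + fps_const (s * q ^ k) * Z) $ j"
      using c0 c1 c2[of "j - 2"]
      by (cases j rule: nat.exhaust; cases "j - 1" rule: nat.exhaust) (auto simp: fps_X_def)
    finally show ?thesis .
  qed
  then show ?thesis unfolding den num by (rule fps_ext)
qed

theorem proposition3p2:
  fixes k :: nat
  assumes "k \<ge> 2"
  shows
    "FO_gf k =
       (let z = (fps_X :: rat fps fps); q = fps_const (fps_X :: rat fps) in
          (q * (1 - q) ^ k + q ^ (k + 1) * (1 - 2 * z) - q ^ k * (1 - z))
          / ((1 - 2 * q) * ((1 - q) ^ k - q ^ k * (1 - q + z * q))))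
     \<and>
     FO_gf k =
       (let q = (fps_X :: rat fps) in
          fps_const (q * ((1 - q) ^ (k - 1) - q ^ (k - 1))
                     / ((1 - 2 * q) * ((1 - q) ^ (k - 1) - q ^ k)))
          + Abs_fps (\<lambda>j. if j = 0 then 0 else
              q ^ (j * k + j - 1) * ((1 - q) ^ k - q ^ k)
              / ((1 - 2 * q) * (1 - q) ^ (j - 1) * ((1 - q) ^ (k - 1) - q ^ k) ^ (j + 1))))"
proof -
  define den where "den = (1 - 2 * Q) * ((1 - Q) ^ k - Q ^ k * (1 - Q + Z * Q))"
  define num where "num = Q * (1 - Q) ^ k + Q ^ (k + 1) * (1 - 2 * Z) - Q ^ k * (1 - Z)"
  define q where "q = (fps_X :: rat fps)"
  define R0 where "R0 = q * ((1 - q) ^ (k - 1) - q ^ (k - 1))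
      / ((1 - 2 * q) * ((1 - q) ^ (k - 1) - q ^ k))"
  define R where "R j = q ^ (j * k + j - 1) * ((1 - q) ^ k - q ^ k)
      / ((1 - 2 * q) * (1 - q) ^ (j - 1) * ((1 - q) ^ (k - 1) - q ^ k) ^ (j + 1))" for j
  have den0: "den $ 0 $ 0 \<noteq> 0"
    using assms by (simp add: den_def fps_nth_power_0 zero_power)
  then have den_nz: "den \<noteq> 0" by auto
  have F: "FO_gf k * den = num"
    using FO_gf_cross_multiplied[of k] assms by (simp add: den_def num_def)
  then have "FO_gf k * den = num / den * den"
    using bivariate_divide_mult[OF den0] by simp
  then have first: "FO_gf k = num / den"
    using den_nz by simp
  \<comment> \<open>Both series give \<open>num\<close> when multiplied by the nonzero
    \<open>den\<close>, so they agree.\<close>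
  have "Abs_fps (\<lambda>j. if j = 0 then R0 else R j) * den = num"
    unfolding den_def num_def
    by (rule second_form_cross_multiplied) (use assms in \<open>auto simp: R0_def R_def q_def\<close>)
  then have "FO_gf k = Abs_fps (\<lambda>j. if j = 0 then R0 else R j)"
    using F den_nz by (metis mult_right_cancel)
  also have "\<dots> = fps_const R0 + Abs_fps (\<lambda>j. if j = 0 then 0 else R j)"
    by (simp add: fps_eq_iff)
  finally show ?thesis
    using first by (simp only: Let_def den_def num_def R0_def R_def q_def simp_thms)
qed

end
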